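(* There is an absolute constant $c>0$ such that for every constant $a>0$ there are infinitely many $n\in\mathbb{N}$ for which there exists $\mathcal{F}\subseteq\{-1,1\}^n$ with (a) $\gamma = d^{-a}$, and (b) $|\mathcal{F}| = \left\lfloor \exp\!\left(c\, n^{\frac{1}{2a+1}}\right)\right\rfloor$, where $\gamma = \gamma_{\mathrm{orth}}(\mathcal{F})$ and $d = \mathrm{VC}(\mathcal{F})$.
   Context: For $x,y \in \{-1,1\}^n$, $\langle x,y\rangle = \frac{1}{n}\sum_{i=1}^n x_i y_i$, and for $\mathcal{F}\subseteq\{-1,1\}^n$ with at least two elements, $\gamma_{\mathrm{orth}}(\mathcal{F}) = \max\{|\langle x,y\rangle| : x \ne y \in \mathcal{F}\}$. For an index sequence $I=(i_1,\dots,i_k)$ of distinct coordinates, $\mathcal{F}$ shatters $I$ if $\{(x_{i_1},\dots,x_{i_k}) : x\in\mathcal{F}\} = \{-1,1\}^k$; $\mathrm{VC}(\mathcal{F})$ is the largest size of a shattered index sequence.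
   Formalization: (a) is proved exactly if m^a is an integer for some integer m ≥ 2 (e.g. a rational); for all other a it reads γ = ⌊n d^(-a)⌋/n, since γ is rational and exact equality fails for all but countably many a (a few exceptional irrational a, e.g. 2^a = 5/2, may also get only the rounded form). *)

theory Defs
  imports Complex_Main "HOL-Library.FuncSet"
begin

text \<open>The coordinates of a point of the cube in dimension \<open>n\<close> are indexed by \<open>0, \<dots>, n - 1\<close>. The
  extensional function space makes each sign vector a unique function, so that equality and
  cardinality of sets of sign vectors are the intended ones.\<close>

definition cube :: "nat \<Rightarrow> (nat \<Rightarrow> real) set" where
  "cube n = {..<n} \<rightarrow>\<^sub>E {-1, 1}"

definition nip :: "nat \<Rightarrow> (nat \<Rightarrow> real) \<Rightarrow> (nat \<Rightarrow> real) \<Rightarrow> real" where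
  "nip n x y = (1 / real n) * (\<Sum>i<n. x i * y i)"

text \<open>Only meaningful if \<open>F\<close> is finite and has at least two elements; otherwise \<open>Max\<close> is applied
  to an empty or infinite set.\<close>

definition gamma_orth :: "nat \<Rightarrow> (nat \<Rightarrow> real) set \<Rightarrow> real" where
  "gamma_orth n F = Max {\<bar>nip n x y\<bar> | x y. x \<in> F \<and> y \<in> F \<and> x \<noteq> y}"

definition shatters :: "nat \<Rightarrow> (nat \<Rightarrow> real) set \<Rightarrow> nat list \<Rightarrow> bool" where
  "shatters n F I \<longleftrightarrow> distinct I \<and> set I \<subseteq> {..<n} \<and>
     (\<lambda>x. map x I) ` F = {v. length v = length I \<and> set v \<subseteq> {-1, 1}}"

text \<open>The set below is finite, and it contains \<open>0\<close> (empty sequence) as soon as \<open>F\<close> is nonempty.\<close>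

definition VC :: "nat \<Rightarrow> (nat \<Rightarrow> real) set \<Rightarrow> nat" where
  "VC n F = Max {length I | I. shatters n F I}"

text \<open>\<open>gamma_orth n F\<close> is a rational number with denominator \<open>n\<close>, so it can equal \<open>d powr (- a)\<close> for
  some \<open>d \<ge> 2\<close> only if \<open>d powr a\<close> is rational, which fails for all but countably many \<open>a\<close>; and
  \<open>d = 1\<close> would force \<open>card F \<le> n + 1\<close>. The equality \<open>gamma_orth n F = d powr (- a)\<close> is therefore demanded
  exactly whenever \<open>m powr a\<close> is a natural number for some \<open>m \<ge> 2\<close> (for instance whenever \<open>a\<close> is
  rational), and for the other \<open>a\<close> it is read as equality after rounding \<open>d powr (- a)\<close> down to
  a multiple of \<open>1 / n\<close>.\<close>

end

theory Submission
  imports Defs "HOL-Library.Infinite_Set"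
begin

text \<open>Choose \<open>n\<close> of order \<open>d powr (2 * a + 1)\<close> so that the required cardinality lies between
  \<open>2 ^ d\<close> and \<open>2 ^ (d + 1)\<close>; the VC dimension is then at most \<open>d\<close> for free, and equals \<open>d\<close> once the
  first \<open>d\<close> coordinates are shattered. Start from two vectors whose inner sum is exactly
  \<open>g = \<lfloor>n / d powr a\<rfloor>\<close> (possible if \<open>g\<close> and \<open>n\<close> have the same parity) and add vectors greedily,
  prescribing their first \<open>d\<close> signs and choosing the others so that the potential
  \<open>\<Sum>y. cosh (l * (\<Sum>i. z i * y i))\<close> stays small, which keeps all inner sums within \<open>g\<close>.\<close>

section \<open>Choosing signs by a cosh potential\<close>

text \<open>By cosh(A + B) + cosh(A - B) = 2 cosh A cosh B, the potentials for the two signs add up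
  to twice the right-hand side, so one of them does not exceed it.\<close>

lemma cosh_step_le:
  fixes A :: "'a set" and u v :: "'a \<Rightarrow> real" and l :: real
  assumes "\<And>y. y \<in> A \<Longrightarrow> v y \<in> {-1, 1}"
  shows "\<exists>s\<in>{-1, 1}. (\<Sum>y\<in>A. cosh (l * (u y + s * v y))) \<le> cosh l * (\<Sum>y\<in>A. cosh (l * u y))"
proof -
  have "cosh (l * (u y + 1 * v y)) + cosh (l * (u y + (-1) * v y)) = 2 * (cosh l * cosh (l * u y))"
    if "y \<in> A" for y
  proof -
    have "v y = -1 \<or> v y = 1" using assms[OF that] by auto
    then show ?thesis
      by (auto simp: distrib_left right_diff_distrib cosh_add cosh_diff)
  qed
  then have "(\<Sum>y\<in>A. cosh (l * (u y + 1 * v y))) + (\<Sum>y\<in>A. cosh (l * (u y + (-1) * v y)))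
      = 2 * (cosh l * (\<Sum>y\<in>A. cosh (l * u y)))"
    by (simp add: sum.distrib[symmetric] sum_distrib_left)
  then have "(\<Sum>y\<in>A. cosh (l * (u y + 1 * v y))) \<le> cosh l * (\<Sum>y\<in>A. cosh (l * u y)) \<or>
      (\<Sum>y\<in>A. cosh (l * (u y + (-1) * v y))) \<le> cosh l * (\<Sum>y\<in>A. cosh (l * u y))"
    by linarith
  then show ?thesis by blast
qed

text \<open>Derandomisation: the missing coordinates are chosen one at a time so that the potential does
  not exceed its average over both signs.\<close>

lemma extend_prefix:
  fixes S :: "(nat \<Rightarrow> real) set" and v :: "real list"
  assumes S: "S \<subseteq> cube n"
    and v: "length v = d" "set v \<subseteq> {-1, 1}" and dn: "d \<le> n"
  shows "\<exists>z\<in>cube n. map z [0..<d] = v \<and>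
    (\<Sum>y\<in>S. cosh (l * (\<Sum>i<n. z i * y i)))
      \<le> cosh l ^ (n - d) * (\<Sum>y\<in>S. cosh (l * (\<Sum>i<d. z i * y i)))"
proof -
  have Sv: "y i \<in> {-1, 1}" if "y \<in> S" "i < n" for y i
    using S that by (auto simp: cube_def PiE_def Pi_def)
  \<comment> \<open>The guard \<open>m \<le> n\<close> is carried through the induction because
    \<open>y m\<close> is known to be a sign only for \<open>m < n\<close>.\<close>
  have "m \<le> n \<longrightarrow> (\<exists>z\<in>cube m. map z [0..<d] = v \<and>
    (\<Sum>y\<in>S. cosh (l * (\<Sum>i<m. z i * y i)))
      \<le> cosh l ^ (m - d) * (\<Sum>y\<in>S. cosh (l * (\<Sum>i<d. z i * y i))))" if "d \<le> m" for m
    using that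
  proof (induction m rule: dec_induct)
    case base
    define z where "z = (\<lambda>i. if i < d then v ! i else undefined)"
    have "z \<in> cube d"
      using v(1) subsetD[OF v(2) nth_mem] by (auto simp: cube_def z_def PiE_iff extensional_def)
    moreover have "map z [0..<d] = v"
      using v by (intro nth_equalityI) (auto simp: z_def)
    ultimately show ?case by (intro impI bexI[of _ z]) auto
  next
    case (step m)
    show ?case
    proof
      assume m: "Suc m \<le> n"
      then obtain z where z: "z \<in> cube m" "map z [0..<d] = v"
        and le: "(\<Sum>y\<in>S. cosh (l * (\<Sum>i<m. z i * y i)))
          \<le> cosh l ^ (m - d) * (\<Sum>y\<in>S. cosh (l * (\<Sum>i<d. z i * y i)))"
        using step.IH by auto
      obtain s where s: "s \<in> {-1, 1}"
        and sle: "(\<Sum>y\<in>S. cosh (l * ((\<Sum>i<m. z i * y i) + s * y m)))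
          \<le> cosh l * (\<Sum>y\<in>S. cosh (l * (\<Sum>i<m. z i * y i)))"
        using cosh_step_le[of S "\<lambda>y. y m" l "\<lambda>y. \<Sum>i<m. z i * y i"] Sv[of _ m] m
        unfolding Suc_le_eq by blast
      define z' where "z' = z(m := s)"
      \<comment> \<open>Applied with \<open>k = m\<close> to the running sums and with
        \<open>k = d\<close> to the prefix sums.\<close>
      have eq: "(\<Sum>i<k. z' i * y i) = (\<Sum>i<k. z i * y i)" if "k \<le> m" for k y
        using that by (intro sum.cong) (auto simp: z'_def)
      have 1: "z' \<in> cube (Suc m)"
        using z(1) s by (auto simp: cube_def z'_def PiE_iff extensional_def less_Suc_eq)
      have 2: "map z' [0..<d] = v"
        using z(2) step.hyps by (auto simp: z'_def)
      have "(\<Sum>y\<in>S. cosh (l * (\<Sum>i<Suc m. z' i * y i)))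
          = (\<Sum>y\<in>S. cosh (l * ((\<Sum>i<m. z i * y i) + s * y m)))"
        by (simp add: eq) (simp add: z'_def)
      also note sle
      also have "cosh l * (\<Sum>y\<in>S. cosh (l * (\<Sum>i<m. z i * y i)))
          \<le> cosh l * (cosh l ^ (m - d) * (\<Sum>y\<in>S. cosh (l * (\<Sum>i<d. z i * y i))))"
        using le by (intro mult_left_mono) auto
      also have "\<dots> = cosh l ^ (Suc m - d) * (\<Sum>y\<in>S. cosh (l * (\<Sum>i<d. z' i * y i)))"
        using step.hyps by (simp add: eq Suc_diff_le)
      finally show "\<exists>z\<in>cube (Suc m). map z [0..<d] = v \<and>
        (\<Sum>y\<in>S. cosh (l * (\<Sum>i<Suc m. z i * y i)))
          \<le> cosh l ^ (Suc m - d) * (\<Sum>y\<in>S. cosh (l * (\<Sum>i<d. z i * y i)))"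
        using 1 2 by auto
    qed
  qed
  then show ?thesis using dn by simp
qed

section \<open>Inner sums of sign vectors\<close>

lemma cube_inner_Ints:
  assumes "x \<in> cube n" "y \<in> cube n" "m \<le> n"
  shows "(\<Sum>i<m. x i * y i) \<in> \<int>"
proof (rule Ints_sum)
  fix i assume "i \<in> {..<m}"
  then have "x i \<in> {-1, 1}" "y i \<in> {-1, 1}"
    using assms by (auto simp: cube_def PiE_iff)
  then show "x i * y i \<in> \<int>" by auto
qed

lemma cube_inner_le:
  assumes "x \<in> cube n" "y \<in> cube n" "m \<le> n"
  shows "\<bar>\<Sum>i<m. x i * y i\<bar> \<le> real m"
proof -
  have "\<bar>x i * y i\<bar> \<le> 1" if "i \<in> {..<m}" for i
  proof -
    have "x i \<in> {-1, 1}" "y i \<in> {-1, 1}"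
      using assms that by (auto simp: cube_def PiE_iff)
    then show ?thesis by auto
  qed
  then have "(\<Sum>i<m. \<bar>x i * y i\<bar>) \<le> of_nat (card {..<m}) * 1"
    by (rule sum_bounded_above)
  then show ?thesis by (intro order_trans[OF sum_abs]) simp
qed

lemma cube_inner_self:
  assumes "x \<in> cube n"
  shows "(\<Sum>i<n. x i * x i) = real n"
proof -
  have "x i * x i = 1" if "i < n" for i
  proof -
    have "x i \<in> {-1, 1}" using assms that by (auto simp: cube_def PiE_iff)
    then show ?thesis by auto
  qed
  then have "(\<Sum>i<n. x i * x i) = (\<Sum>i<n. 1)" by simp
  then show ?thesis by simp
qed

lemma cosh_mono_abs:
  fixes x y :: real
  assumes "\<bar>x\<bar> \<le> \<bar>y\<bar>"
  shows "cosh x \<le> cosh y"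
  using assms cosh_real_nonneg_le_iff[of "\<bar>x\<bar>" "\<bar>y\<bar>"] by (simp add: cosh_real_abs)

text \<open>The prefix sums are at most \<open>d\<close> in absolute value, so the potential after
  the extension stays below \<open>cosh (l * (real g + 1))\<close>. An inner sum exceeding
  \<open>g\<close> would, being an integer, reach \<open>g + 1\<close>, and its term alone would
  break this bound.\<close>

lemma extend_incoherent:
  fixes S :: "(nat \<Rightarrow> real) set" and l :: real
  assumes S: "S \<subseteq> cube n" "finite S"
    and v: "length v = d" "set v \<subseteq> {-1, 1}" and dn: "d \<le> n"
    and l: "l > 0"
    and small: "real (card S) * cosh l ^ (n - d) * cosh (l * real d) < cosh (l * (real g + 1))"
  shows "\<exists>z\<in>cube n. map z [0..<d] = v \<and> (\<forall>y\<in>S. \<bar>\<Sum>i<n. z i * y i\<bar> \<le> real g)"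
proof -
  obtain z where z: "z \<in> cube n" "map z [0..<d] = v"
    and le: "(\<Sum>y\<in>S. cosh (l * (\<Sum>i<n. z i * y i)))
      \<le> cosh l ^ (n - d) * (\<Sum>y\<in>S. cosh (l * (\<Sum>i<d. z i * y i)))"
    using extend_prefix[OF S(1) v dn, of l] by blast
  have "(\<Sum>y\<in>S. cosh (l * (\<Sum>i<d. z i * y i))) \<le> real (card S) * cosh (l * real d)"
  proof (rule sum_bounded_above)
    fix y assume "y \<in> S"
    then have "\<bar>\<Sum>i<d. z i * y i\<bar> \<le> real d" using cube_inner_le z S dn by blast
    then show "cosh (l * (\<Sum>i<d. z i * y i)) \<le> cosh (l * real d)"
      using l by (intro cosh_mono_abs) (simp add: abs_mult)
  qed
  then have "cosh l ^ (n - d) * (\<Sum>y\<in>S. cosh (l * (\<Sum>i<d. z i * y i)))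
      \<le> cosh l ^ (n - d) * (real (card S) * cosh (l * real d))"
    by (intro mult_left_mono) auto
  also have "\<dots> < cosh (l * (real g + 1))" using small by (simp add: mult_ac)
  finally have lt: "(\<Sum>y\<in>S. cosh (l * (\<Sum>i<n. z i * y i))) < cosh (l * (real g + 1))"
    using le by linarith
  have "\<bar>\<Sum>i<n. z i * y i\<bar> \<le> real g" if y: "y \<in> S" for y
  proof (rule ccontr)
    assume gt: "\<not> \<bar>\<Sum>i<n. z i * y i\<bar> \<le> real g"
    obtain k where k: "(\<Sum>i<n. z i * y i) = of_int k"
      using cube_inner_Ints[of z n y n] z y S by (auto elim: Ints_cases)
    have "int g < \<bar>k\<bar>" using gt unfolding k by linarith
    then have "real g + 1 \<le> \<bar>\<Sum>i<n. z i * y i\<bar>" unfolding k by linarith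
    then have "cosh (l * (real g + 1)) \<le> cosh (l * (\<Sum>i<n. z i * y i))"
      using l by (intro cosh_mono_abs) (simp add: abs_mult)
    also have "\<dots> \<le> (\<Sum>y\<in>S. cosh (l * (\<Sum>i<n. z i * y i)))"
      by (rule member_le_sum[OF y _ S(2), of "\<lambda>y. cosh (l * (\<Sum>i<n. z i * y i))"]) simp
    finally show False using lt by simp
  qed
  with z show ?thesis by blast
qed

section \<open>Greedy construction of the shattering family\<close>

definition sign_lists :: "nat \<Rightarrow> real list set" where
  "sign_lists d = {v. length v = d \<and> set v \<subseteq> {-1, 1}}"

lemma finite_sign_lists: "finite (sign_lists d)"
  using finite_lists_length_eq[of "{-1, 1 :: real}" d] by (simp add: sign_lists_def conj_commute)

lemma card_sign_lists: "card (sign_lists d) = 2 ^ d"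
  using card_lists_length_eq[of "{-1, 1 :: real}" d]
  by (simp add: sign_lists_def conj_commute numeral_2_eq_2)

lemma restrict_cube_sign_lists:
  assumes "x \<in> cube n" "d \<le> n"
  shows "map x [0..<d] \<in> sign_lists d"
  using assms by (auto simp: sign_lists_def cube_def PiE_iff)

text \<open>Each added vector receives a prefix not yet present, as long as one is missing, so
  \<open>2 ^ d\<close> vectors suffice to shatter the first \<open>d\<close> coordinates. The
  starting pair has inner sum exactly \<open>g\<close>, which turns the upper bound on
  \<open>gamma_orth\<close> into an equality.\<close>

lemma incoherent_shattering_family:
  fixes l :: real
  assumes d: "0 < d" "d \<le> n" and g: "g < n" "even (n - g)"
    and N: "2 ^ d \<le> N" "N \<le> 2 ^ (d + 1)" and l: "l > 0"
    and small: "2 ^ (d + 1) * cosh l ^ (n - d) * cosh (l * real d) < cosh (l * (real g + 1))"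
  shows "\<exists>F\<subseteq>cube n. card F = N \<and> shatters n F [0..<d] \<and> gamma_orth n F = real g / real n"
proof -
  define x0 :: "nat \<Rightarrow> real" where "x0 = (\<lambda>i. if i < n then 1 else undefined)"
  \<comment> \<open>With \<open>(n - g) div 2\<close> entries -1, the inner sum with the all-ones
    vector is \<open>n - (n - g) = g\<close>; this uses that \<open>n - g\<close> is even.\<close>
  define y0 :: "nat \<Rightarrow> real"
    where "y0 = (\<lambda>i. if i < n then if i < (n - g) div 2 then -1 else 1 else undefined)"
  define good where "good = (\<lambda>F. F \<subseteq> cube n \<and> finite F \<and> x0 \<in> F \<and> y0 \<in> F \<and>
     (\<forall>x\<in>F. \<forall>y\<in>F. x \<noteq> y \<longrightarrow> \<bar>\<Sum>i<n. x i * y i\<bar> \<le> real g))"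
  define restr where "restr = (\<lambda>x :: nat \<Rightarrow> real. map x [0..<d])"
  have xy: "x0 \<in> cube n" "y0 \<in> cube n"
    by (auto simp: cube_def PiE_iff x0_def y0_def extensional_def)
  obtain k where k: "n - g = 2 * k" using g(2) by (rule evenE)
  then have ng: "0 < (n - g) div 2" using g(1) by simp
  \<comment> \<open>As \<open>g < n\<close>, coordinate 0 is among the flipped ones, and it lies in
    the prefix because \<open>0 < d\<close>. The starting pair therefore already accounts for two
    prefixes.\<close>
  have x0y0: "restr x0 \<noteq> restr y0"
  proof
    assume "restr x0 = restr y0"
    then have "x0 0 = y0 0" using d by (auto simp: restr_def)
    then show False using ng d by (auto simp: x0_def y0_def)
  qed
  have inner: "(\<Sum>i<n. x0 i * y0 i) = real g"
  proof -
    have nk: "n = g + 2 * k" using k g by simp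
    have "(\<Sum>i<n. x0 i * y0 i) = (\<Sum>i<n. (if i \<in> {..<k} then -1 else 1))"
      using k by (intro sum.cong) (auto simp: x0_def y0_def)
    also have "\<dots> = (\<Sum>i\<in>{..<n} \<inter> {i. i \<in> {..<k}}. -1) + (\<Sum>i\<in>{..<n} \<inter> - {i. i \<in> {..<k}}. 1)"
      by (rule sum.If_cases) simp
    also have "{..<n} \<inter> {i. i \<in> {..<k}} = {..<k}" using nk by auto
    also have "{..<n} \<inter> - {i. i \<in> {..<k}} = {k..<n}" by auto
    finally show ?thesis using nk by simp
  qed
  have family: "\<exists>F. good F \<and> card F = k \<and> min k (2 ^ d) \<le> card (restr ` F)"
    if "2 \<le> k" "k \<le> 2 ^ (d + 1)" for k
    using that
  proof (induction k rule: dec_induct)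
    case base
    have "good {x0, y0}"
      using xy inner by (auto simp: good_def mult.commute)
    moreover have "card {x0, y0} = 2" "card (restr ` {x0, y0}) = 2"
      using x0y0 by (cases "x0 = y0"; simp)+
    ultimately show ?case by (intro exI[of _ "{x0, y0}"]) auto
  next
    case (step k)
    then obtain F where F: "good F" "card F = k" "min k (2 ^ d) \<le> card (restr ` F)" by auto
    have sub: "restr ` F \<subseteq> sign_lists d"
      using F restrict_cube_sign_lists d by (auto simp: good_def restr_def)
    \<comment> \<open>If every prefix occurs already, any one will do, for instance that of
      \<open>x0\<close>.\<close>
    obtain v where v: "v \<in> sign_lists d" "restr ` F = sign_lists d \<or> v \<notin> restr ` F"
      using sub restrict_cube_sign_lists[OF xy(1) d(2)] by auto
    have "real (card F) \<le> 2 ^ (d + 1)" using F(2) step.prems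
      by (metis Suc_leD numeral_power_eq_of_nat_cancel_iff of_nat_le_iff)
    then have "real (card F) * cosh l ^ (n - d) * cosh (l * real d)
        \<le> 2 ^ (d + 1) * cosh l ^ (n - d) * cosh (l * real d)"
      by (intro mult_right_mono) auto
    with small have "real (card F) * cosh l ^ (n - d) * cosh (l * real d) < cosh (l * (real g + 1))"
      by linarith
    then obtain z where z: "z \<in> cube n" "restr z = v" "\<forall>y\<in>F. \<bar>\<Sum>i<n. z i * y i\<bar> \<le> real g"
      using extend_incoherent[of F n v d l g] F(1) v(1) d l
      by (auto simp: good_def restr_def sign_lists_def)
    \<comment> \<open>A member of \<open>F\<close> would have inner sum \<open>n > g\<close> with
      itself.\<close>
    have zF: "z \<notin> F"
      using z cube_inner_self[OF z(1)] g by auto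
    have "good (insert z F)"
      using F(1) z by (auto simp: good_def mult.commute)
    moreover have "card (insert z F) = Suc k"
      using zF F by (simp add: good_def)
    moreover have "min (Suc k) (2 ^ d) \<le> card (restr ` insert z F)"
    proof (cases "restr ` F = sign_lists d")
      case True
      then have "restr ` insert z F = sign_lists d" using v z by auto
      then show ?thesis by (simp add: card_sign_lists)
    next
      case False
      then have "card (restr ` insert z F) = Suc (card (restr ` F))"
        using v z finite_subset[OF sub finite_sign_lists] by simp
      then show ?thesis using F(3) by linarith
    qed
    ultimately show ?case by blast
  qed
  have "2 \<le> N" using N(1) d power_increasing[of 1 d "2 :: nat"] by simp
  then obtain F where F: "good F" "card F = N" "min N (2 ^ d) \<le> card (restr ` F)"
    using family N by blast
  have sub: "restr ` F \<subseteq> sign_lists d"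
    using F restrict_cube_sign_lists d by (auto simp: good_def restr_def)
  then have "restr ` F = sign_lists d"
    using F(3) N(1) by (intro card_seteq finite_sign_lists) (auto simp: card_sign_lists)
  then have sh: "shatters n F [0..<d]"
    using d by (auto simp: shatters_def restr_def sign_lists_def)
  have n: "real n > 0" using g by simp
  have "gamma_orth n F = real g / real n"
    unfolding gamma_orth_def
  proof (rule Max_eqI)
    have "{\<bar>nip n x y\<bar> |x y. x \<in> F \<and> y \<in> F \<and> x \<noteq> y} \<subseteq> (\<lambda>(x, y). \<bar>nip n x y\<bar>) ` (F \<times> F)"
      by auto
    then show "finite {\<bar>nip n x y\<bar> |x y. x \<in> F \<and> y \<in> F \<and> x \<noteq> y}"
      by (rule finite_subset) (use F(1) in \<open>simp add: good_def\<close>)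
  next
    fix r assume "r \<in> {\<bar>nip n x y\<bar> |x y. x \<in> F \<and> y \<in> F \<and> x \<noteq> y}"
    then show "r \<le> real g / real n"
      using F(1) n by (auto simp: good_def nip_def abs_mult divide_right_mono)
  next
    have "\<bar>nip n x0 y0\<bar> = real g / real n" by (simp add: nip_def inner)
    then show "real g / real n \<in> {\<bar>nip n x y\<bar> |x y. x \<in> F \<and> y \<in> F \<and> x \<noteq> y}"
      using F(1) x0y0 by (force simp: good_def)
  qed
  with F sh show ?thesis by (auto simp: good_def)
qed

text \<open>Shattering a sequence of length k takes at least 2^k members, so the cardinality bound
  excludes every longer sequence.\<close>

lemma VC_eqI:
  assumes "shatters n F I" "finite F" "card F < 2 ^ (length I + 1)"
  shows "VC n F = length I"
  unfolding VC_def
proof (rule Max_eqI)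
  have le: "length J \<le> length I" if "shatters n F J" for J
  proof -
    have "(\<lambda>x. map x J) ` F = sign_lists (length J)"
      using that by (simp add: shatters_def sign_lists_def)
    then have "2 ^ length J \<le> card F"
      using card_image_le[OF assms(2), of "\<lambda>x. map x J"] by (simp add: card_sign_lists)
    with assms(3) have "(2 :: nat) ^ length J < 2 ^ (length I + 1)" by linarith
    then show ?thesis by (simp add: power_strict_increasing_iff flip: power_Suc)
  qed
  then show "r \<le> length I" if "r \<in> {length I | I. shatters n F I}" for r using that by auto
  have "{length I | I. shatters n F I} \<subseteq> {..length I}" using le by auto
  then show "finite {length I | I. shatters n F I}" by (rule finite_subset) simp
  show "length I \<in> {length I | I. shatters n F I}" using assms(1) by blast
qed

section \<open>Numerical estimates and the choice of cardinality\<close>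

text \<open>Averaging exp x \<le> 1 + x + x^2 and exp(-x) \<le> 1 - x + x^2 gives cosh x \<le> 1 +
  x^2.\<close>

lemma cosh_le_exp_square:
  fixes x :: real
  assumes "0 \<le> x" "x \<le> 1"
  shows "cosh x \<le> exp (x ^ 2)"
proof -
  have 1: "exp x \<le> 1 + x + x ^ 2" using exp_bound[OF assms] .
  have "exp (-x) \<le> inverse (1 + x)"
    using exp_ge_add_one_self[of x] assms by (simp add: exp_minus le_imp_inverse_le)
  also have "\<dots> \<le> 1 - x + x ^ 2"
  proof -
    \<comment> \<open>The product is 1 + x^3.\<close>
    have "1 \<le> (1 - x + x ^ 2) * (1 + x)"
      using assms by (simp add: algebra_simps power2_eq_square)
    then show ?thesis using assms by (simp add: inverse_eq_divide divide_le_eq)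
  qed
  finally have "cosh x \<le> 1 + x ^ 2" using 1 by (simp add: cosh_field_def)
  also have "\<dots> \<le> exp (x ^ 2)" by (rule exp_ge_add_one_self)
  finally show ?thesis .
qed

text \<open>The choice \<open>l = 1 / (2 * t)\<close> maximises \<open>l * n / t - n * l ^ 2\<close>.\<close>

lemma potential_small:
  fixes t :: real
  assumes d: "2 \<le> d" "d \<le> n" and t: "1 \<le> t" and n: "16 * real d * t ^ 2 \<le> real n"
    and g: "real n / t \<le> real g + 1"
  shows "2 ^ (d + 1) * cosh (1 / (2 * t)) ^ (n - d) * cosh (1 / (2 * t) * real d)
    < cosh (1 / (2 * t) * (real g + 1))"
proof -
  define l where "l = 1 / (2 * t)"
  have l: "0 < l" "l \<le> 1 / 2" using t by (auto simp: l_def divide_simps)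
  have two: "(2 :: real) \<le> exp 1" using exp_ge_add_one_self[of 1] by simp
  have "cosh l ^ (n - d) \<le> exp (l ^ 2) ^ (n - d)"
    using l by (intro power_mono cosh_le_exp_square) auto
  also have "\<dots> = exp (real (n - d) * l ^ 2)" by (simp add: exp_of_nat_mult)
  also have "\<dots> \<le> exp (real n * l ^ 2)" by (simp add: mult_right_mono)
  finally have A: "cosh l ^ (n - d) \<le> exp (real n * l ^ 2)" .
  have "cosh (l * real d) \<le> exp (l * real d)"
    using l by (simp add: cosh_field_def divide_simps)
  also have "\<dots> \<le> exp (real d / 2)" using l mult_right_mono[of l "1/2" "real d"] by simp
  finally have B: "cosh (l * real d) \<le> exp (real d / 2)" .
  have C: "(2 :: real) ^ (d + 2) \<le> exp (real (d + 2))"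
    using power_mono[OF two, of "d + 2"] exp_of_nat_mult[of "d + 2" "1 :: real"] by simp
  \<comment> \<open>The extra factor 2 pays for the final bound exp u < 2 cosh u.\<close>
  have "2 * (2 ^ (d + 1) * cosh l ^ (n - d) * cosh (l * real d))
      = 2 ^ (d + 2) * cosh l ^ (n - d) * cosh (l * real d)" by simp
  also have "\<dots> \<le> exp (real (d + 2)) * exp (real n * l ^ 2) * exp (real d / 2)"
    using A B C by (intro mult_mono) auto
  also have "\<dots> = exp (real (d + 2) + real n * l ^ 2 + real d / 2)" by (simp only: exp_add)
  also have "\<dots> < exp (l * (real g + 1))"
  proof -
    \<comment> \<open>Since \<open>l ^ 2 = 1 / (4 * t ^ 2)\<close>, the factor 16 in the hypothesis
      becomes 4. The exponent on the right is at least \<open>2 * (n * l ^ 2)\<close>, so it remains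
      to see that d + 2 + d/2 < 4d, which holds for d \<ge> 2.\<close>
    have n4: "4 * real d \<le> real n * l ^ 2"
      using n t by (simp add: l_def power2_eq_square divide_simps)
    have "2 * (real n * l ^ 2) = l * (real n / t)"
      using t by (simp add: l_def power2_eq_square divide_simps)
    also have "\<dots> \<le> l * (real g + 1)" using g l by (intro mult_left_mono) auto
    finally have "2 * (real n * l ^ 2) \<le> l * (real g + 1)" .
    moreover have "2 \<le> real d" using d by simp
    ultimately have "real (d + 2) + real n * l ^ 2 + real d / 2 < l * (real g + 1)"
      using n4 unfolding of_nat_add by linarith
    then show ?thesis by (simp only: exp_less_cancel_iff)
  qed
  also have "\<dots> < 2 * cosh (l * (real g + 1))" by (simp add: cosh_field_def)
  finally have "2 ^ (d + 1) * cosh l ^ (n - d) * cosh (l * real d) < cosh (l * (real g + 1))"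
    by linarith
  then show ?thesis unfolding l_def .
qed

text \<open>The values \<open>(16 * d) powr (2 * a + 1)\<close> and
  \<open>(16 * (d + 1)) powr (2 * a + 1)\<close> delimit the \<open>n\<close> that go with VC
  dimension \<open>d\<close>. The first claim leaves room there to adjust parity and divisibility;
  the second supplies the size of \<open>n\<close> that the potential bound requires. Both follow by
  splitting off one factor of the power: passing from \<open>16 * d\<close> to
  \<open>16 * (d + 1)\<close> gains 16 times the remaining power.\<close>

lemma powr_gap:
  fixes a :: real
  assumes "a > 0" "d > 0"
  shows "(16 * real d) powr (2 * a + 1) + 16 * (real d powr a) ^ 2
      \<le> (16 * (real d + 1)) powr (2 * a + 1)"
    and "16 * real d * (real d powr a) ^ 2 \<le> (16 * real d) powr (2 * a + 1)"
proof -
  have sq: "(real d powr a) ^ 2 = real d powr (2 * a)"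
    by (simp add: power2_eq_square flip: powr_add)
  have mono: "real d powr (2 * a) \<le> (16 * real d) powr (2 * a)"
    "(16 * real d) powr (2 * a) \<le> (16 * (real d + 1)) powr (2 * a)"
    using assms by (auto intro!: powr_mono2)
  have e: "(16 * real d) powr (2 * a + 1) = 16 * real d * (16 * real d) powr (2 * a)"
    "(16 * (real d + 1)) powr (2 * a + 1) = 16 * (real d + 1) * (16 * (real d + 1)) powr (2 * a)"
    using assms by (auto simp: powr_add)
  show "16 * real d * (real d powr a) ^ 2 \<le> (16 * real d) powr (2 * a + 1)"
    unfolding sq e using mono by (intro mult_left_mono) auto
  have "16 * real d * (16 * real d) powr (2 * a) + 16 * real d powr (2 * a)
      \<le> 16 * (real d + 1) * (16 * real d) powr (2 * a)"
    using mono by (simp add: algebra_simps)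
  also have "\<dots> \<le> 16 * (real d + 1) * (16 * (real d + 1)) powr (2 * a)"
    using mono by (intro mult_left_mono) auto
  finally show "(16 * real d) powr (2 * a + 1) + 16 * (real d powr a) ^ 2
      \<le> (16 * (real d + 1)) powr (2 * a + 1)"
    unfolding sq e .
qed

text \<open>The upper bound on \<open>n\<close> keeps the family smaller than \<open>2 ^ (d + 1)\<close>, so that no sequence
  longer than \<open>d\<close> can be shattered.\<close>

lemma family_of_dimension:
  fixes a :: real
  assumes a: "a > 0" and d: "2 \<le> d" "2 \<le> real d powr a"
    and n: "(16 * real d) powr (2 * a + 1) \<le> real n" "real n < (16 * (real d + 1)) powr (2 * a + 1)"
    and g: "real g \<le> real n / real d powr a" "real n / real d powr a \<le> real g + 1" "even (n + g)"
  shows "\<exists>F\<subseteq>cube n. VC n F = d \<and> gamma_orth n F = real g / real n \<and>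
    int (card F) = \<lfloor>exp (ln 2 / 16 * real n powr (1 / (2 * a + 1)))\<rfloor>"
proof -
  define t where "t = real d powr a"
  \<comment> \<open>The exponent to base 2 of the required cardinality before rounding; the bounds
    on \<open>n\<close> say exactly that \<open>d \<le> q < d + 1\<close>.\<close>
  define q where "q = real n powr (1 / (2 * a + 1)) / 16"
  define N where "N = nat \<lfloor>2 powr q\<rfloor>"
  have N: "exp (ln 2 / 16 * real n powr (1 / (2 * a + 1))) = 2 powr q"
    by (simp add: powr_def q_def)
  have root: "(x powr (2 * a + 1)) powr (1 / (2 * a + 1)) = x" if "x > 0" for x :: real
    using that a by (simp add: powr_powr)
  have "((16 * real d) powr (2 * a + 1)) powr (1 / (2 * a + 1)) \<le> real n powr (1 / (2 * a + 1))"
    using n a by (intro powr_mono2) auto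
  then have q1: "real d \<le> q" using root[of "16 * real d"] d by (simp add: q_def)
  have "real n powr (1 / (2 * a + 1)) < ((16 * (real d + 1)) powr (2 * a + 1)) powr (1 / (2 * a + 1))"
    using n a by (intro powr_less_mono2) auto
  then have q2: "q < real (d + 1)" using root[of "16 * (real d + 1)"] by (simp add: q_def)
  have "2 powr real d \<le> 2 powr q" using q1 by (intro powr_mono) auto
  then have p1: "(2 :: real) ^ d \<le> 2 powr q" by (simp add: powr_realpow)
  have "2 powr q < 2 powr real (d + 1)" using q2 by (intro powr_less_mono) auto
  then have p2: "2 powr q < (2 :: real) ^ (d + 1)" by (subst (asm) powr_realpow) auto
  have N1: "2 ^ d \<le> N" unfolding N_def using p1
    by (simp add: le_nat_iff le_floor_iff)
  have "\<lfloor>2 powr q\<rfloor> < 2 ^ (d + 1)" using p2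
    by (simp add: floor_less_iff)
  then have N2: "N < 2 ^ (d + 1)" unfolding N_def
    by (simp add: nat_less_iff)
  have big: "16 * real d * t ^ 2 \<le> real n" using powr_gap(2)[OF a, of d] d n by (simp add: t_def)
  have t: "2 \<le> t" using d by (simp add: t_def)
  have "1 \<le> t ^ 2" using t by (simp add: one_le_power)
  then have "16 * real d * 1 \<le> 16 * real d * t ^ 2" by (intro mult_left_mono) auto
  with big have dn: "d \<le> n" by linarith
  \<comment> \<open>The hypothesis \<open>2 \<le> real d powr a\<close> serves to make
    \<open>g\<close> strictly smaller than \<open>n\<close>.\<close>
  have "real n / t \<le> real n / 2" using t by (intro divide_left_mono) auto
  with g(1)[folded t_def] have "real g \<le> real n / 2" by linarith
  then have gn: "g < n" using dn d by linarith
  have "even (n - g)" using g gn by simp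
  then obtain F where F: "F \<subseteq> cube n" "card F = N" "shatters n F [0..<d]"
      "gamma_orth n F = real g / real n"
    using incoherent_shattering_family[of d n g N "1 / (2 * t)"] potential_small[of d n t g]
      d dn gn N1 N2 t big g by (auto simp: t_def)
  \<comment> \<open>An infinite set has \<open>card\<close> 0, whereas \<open>N\<close> is
    positive.\<close>
  have "finite F" using F(2) less_le_trans[OF _ N1, of 0] by (intro card_ge_0_finite) simp
  then have "VC n F = d" using VC_eqI[OF F(3)] F(2) N2 by simp
  moreover have "int (card F) = \<lfloor>2 powr q\<rfloor>" using F(2) by (simp add: N_def)
  ultimately show ?thesis using F N by auto
qed

section \<open>Dimensions of suitable parity\<close>

text \<open>Take \<open>n\<close> to be a multiple of \<open>2 * t\<close>: then \<open>n\<close>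
  and \<open>n / t\<close> are both even, and such multiples are only
  \<open>2 * t \<le> 16 * t ^ 2\<close> apart.\<close>

lemma dimension_integral:
  fixes t X :: real
  assumes "t \<in> \<nat>" "t \<ge> 2" "X \<ge> 0"
  shows "\<exists>n g. X \<le> real n \<and> real n < X + 16 * t ^ 2 \<and> real g = real n / t \<and> even (n + g)"
proof -
  obtain s where s: "t = real s" using assms by (auto elim: Nats_cases)
  define k where "k = nat \<lceil>X / (2 * t)\<rceil>"
  have k: "X / (2 * t) \<le> real k" "real k < X / (2 * t) + 1"
    using assms by (auto simp: k_def) linarith+
  have "X \<le> real (2 * s * k)" using k(1) assms by (simp add: s divide_simps mult_ac)
  moreover have "real (2 * s * k) < X + 16 * t ^ 2"
  proof -
    have "2 * t * real k < 2 * t * (X / (2 * t) + 1)" using k assms by (intro mult_strict_left_mono) auto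
    also have "\<dots> = X + 2 * t * 1" using assms by (simp add: distrib_left)
    also have "\<dots> \<le> X + 2 * t * (8 * t)" using assms by (intro add_left_mono mult_left_mono) auto
    finally show ?thesis by (simp add: s power2_eq_square)
  qed
  moreover have "real (2 * k) = real (2 * s * k) / t" using assms by (simp add: s)
  moreover have "even (2 * s * k + 2 * k)" by simp
  ultimately show ?thesis by blast
qed

text \<open>Three consecutive candidates suffice. The floor of n / t rises by at most 1 over two
  steps because 1 / t \<le> 1/2, so it stays constant over the first or the second step, and there
  the parity of \<open>n + g\<close> changes.\<close>

lemma dimension_floor:
  fixes t X :: real
  assumes "t \<ge> 2" "X \<ge> 0"
  shows "\<exists>n g. X \<le> real n \<and> real n < X + 16 * t ^ 2 \<and> int g = \<lfloor>real n / t\<rfloor> \<and> even (n + g)"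
proof -
  define m where "m = nat \<lceil>X\<rceil>"
  define f where "f = (\<lambda>n::nat. nat \<lfloor>real n / t\<rfloor>)"
  have m: "X \<le> real m" "real m < X + 1" using assms by (auto simp: m_def) linarith+
  have f: "int (f n) = \<lfloor>real n / t\<rfloor>" for n using assms by (simp add: f_def)
  have s: "real (Suc n) / t = real n / t + 1 / t" for n by (simp add: add_divide_distrib)
  have t: "0 < 1 / t" "1 / t \<le> 1 / 2" using assms by (auto simp: divide_simps)
  have fl: "real (f n) \<le> real n / t" "real n / t < real (f n) + 1" for n
    using f[of n] by linarith+
  have "f m \<le> f (Suc m)" "f (Suc m) \<le> f m + 1" "f (Suc m) \<le> f (Suc (Suc m))"
    "f (Suc m) = f m + 1 \<Longrightarrow> f (Suc (Suc m)) \<le> f m + 1"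
    using fl[of m] fl[of "Suc m", unfolded s] fl[of "Suc (Suc m)", unfolded s] t
    by linarith+
  then have "f (m + 1) = f m \<or> f (m + 1) = f m + 1 \<and> f (m + 2) = f m + 1"
    by fastforce
  then have "even (m + f m) \<or> even (m + 1 + f (m + 1)) \<or> even (m + 2 + f (m + 2))" by auto
  then obtain n where n: "n = m \<or> n = m + 1 \<or> n = m + 2" "even (n + f n)" by blast
  have "16 * 1 \<le> 16 * t ^ 2" using assms by (intro mult_left_mono one_le_power) auto
  then have "X \<le> real n" "real n < X + 16 * t ^ 2" using n(1) m by auto
  then show ?thesis using f n by blast
qed

section \<open>Unboundedly many dimensions\<close>

theorem theorem3:
  shows "\<exists>c::real. c > 0 \<and> (\<forall>a::real. a > 0 \<longrightarrow>
    infinite {n::nat. \<exists>F. F \<subseteq> cube n \<and>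
      (if \<exists>m::nat. m \<ge> 2 \<and> real m powr a \<in> \<nat>
       then gamma_orth n F = real (VC n F) powr (- a)
       else gamma_orth n F = of_int \<lfloor>real n * real (VC n F) powr (- a)\<rfloor> / real n) \<and>
      int (card F) = \<lfloor>exp (c * real n powr (1 / (2 * a + 1)))\<rfloor>})"
\<comment> \<open>This constant turns the exponential into 2 to the power
  \<open>n powr (1 / (2 * a + 1)) / 16\<close>; the 16 comes from the condition
  \<open>16 * d * t ^ 2 \<le> n\<close> of the potential bound.\<close>
proof (rule exI[of _ "ln 2 / 16"], intro conjI allI impI)
  show "ln 2 / 16 > (0 :: real)" by simp
next
  fix a :: real
  assume a: "a > 0"
  let ?P = "\<exists>m::nat. m \<ge> 2 \<and> real m powr a \<in> \<nat>"
  show "infinite {n::nat. \<exists>F. F \<subseteq> cube n \<and>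
      (if ?P then gamma_orth n F = real (VC n F) powr (- a)
       else gamma_orth n F = of_int \<lfloor>real n * real (VC n F) powr (- a)\<rfloor> / real n) \<and>
      int (card F) = \<lfloor>exp (ln 2 / 16 * real n powr (1 / (2 * a + 1)))\<rfloor>}"
    unfolding infinite_nat_iff_unbounded
  proof
    fix M :: nat
    have "\<exists>d. M \<le> d \<and> 2 \<le> d \<and> 2 \<le> real d powr a \<and> (?P \<longrightarrow> real d powr a \<in> \<nat>)"
    proof (cases ?P)
      case True
      then obtain m k where m: "2 \<le> m" and k: "real m powr a = real k" by (auto elim: Nats_cases)
      have "1 < real m powr a" using m a by (intro gr_one_powr) auto
      then have k2: "2 \<le> k" using k by simp
      \<comment> \<open>Powers of \<open>m\<close> inherit integrality: if m^a = k then (m^j)^a =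
        k^j. The exponent \<open>Suc M\<close> puts the power above \<open>M\<close> and keeps it at
        least 2.\<close>
      have "real (m ^ Suc M) = real m powr real (Suc M)"
        unfolding of_nat_power using m by (intro powr_realpow[symmetric]) simp
      then have "real (m ^ Suc M) powr a = (real m powr a) powr real (Suc M)"
        by (simp only: powr_powr mult.commute)
      also have "\<dots> = real (k ^ Suc M)"
        unfolding k of_nat_power using k2 by (intro powr_realpow) simp
      finally have eq: "real (m ^ Suc M) powr a = real (k ^ Suc M)" .
      have "M < 2 ^ Suc M" using less_exp[of M] unfolding power_Suc by linarith
      moreover have "(2 :: nat) ^ Suc M \<le> m ^ Suc M" "(2 :: nat) ^ Suc M \<le> k ^ Suc M"
        using m k2 by (auto intro: power_mono simp del: power_Suc)
      moreover have "(2 :: nat) \<le> 2 ^ Suc M" by simp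
      ultimately have "M \<le> m ^ Suc M" "2 \<le> m ^ Suc M" "2 \<le> k ^ Suc M" by linarith+
      then show ?thesis using eq
        by (intro exI[of _ "m ^ Suc M"]) (simp del: power_Suc of_nat_power)
    next
      case False
      \<comment> \<open>The last summand ensures \<open>real d powr a \<ge> 2\<close>.\<close>
      define d where "d = M + 2 + nat \<lceil>2 powr (1 / a)\<rceil>"
      have "2 powr (1 / a) \<le> real d" unfolding d_def by linarith
      then have "(2 powr (1 / a)) powr a \<le> real d powr a" using a by (intro powr_mono2) auto
      then have "2 \<le> real d powr a" using a by (simp add: powr_powr)
      with False show ?thesis by (intro exI[of _ d]) (auto simp: d_def)
    qed
    then obtain d where d: "M \<le> d" "2 \<le> d" "2 \<le> real d powr a" "?P \<longrightarrow> real d powr a \<in> \<nat>" by blast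
    define t where "t = real d powr a"
    define X where "X = (16 * real d) powr (2 * a + 1)"
    have X: "X \<ge> 0" "X + 16 * t ^ 2 \<le> (16 * (real d + 1)) powr (2 * a + 1)" "16 * real d * t ^ 2 \<le> X"
      using powr_gap[OF a, of d] d by (auto simp: X_def t_def)
    have t: "2 \<le> t" using d by (simp add: t_def)
    have "\<exists>n g. X \<le> real n \<and> real n < X + 16 * t ^ 2 \<and> int g = \<lfloor>real n / t\<rfloor> \<and> even (n + g) \<and>
        (?P \<longrightarrow> real g = real n / t)"
    proof (cases ?P)
      case True
      then obtain n g where "X \<le> real n" "real n < X + 16 * t ^ 2" "real g = real n / t" "even (n + g)"
        using dimension_integral[of t X] d t X(1) by (auto simp: t_def)
      moreover from this have "int g = \<lfloor>real n / t\<rfloor>" by (metis floor_of_nat)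
      ultimately show ?thesis by blast
    next
      case False
      then show ?thesis using dimension_floor[OF t X(1)] by blast
    qed
    then obtain n g where n: "X \<le> real n" "real n < X + 16 * t ^ 2"
      and g: "int g = \<lfloor>real n / t\<rfloor>" "even (n + g)" "?P \<longrightarrow> real g = real n / t" by blast
    have "real g \<le> real n / t" "real n / t \<le> real g + 1" using g(1) by linarith+
    then obtain F where F: "F \<subseteq> cube n" "VC n F = d" "gamma_orth n F = real g / real n"
      "int (card F) = \<lfloor>exp (ln 2 / 16 * real n powr (1 / (2 * a + 1)))\<rfloor>"
      using family_of_dimension[OF a d(2,3), of n g] n X g by (auto simp: X_def t_def)
    \<comment> \<open>From n \<ge> 16 d t^2 \<ge> 16 d > d \<ge> M, large \<open>d\<close> forces
      large \<open>n\<close>.\<close>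
    have "1 \<le> t ^ 2" using t by (simp add: one_le_power)
    then have "16 * real d * 1 \<le> 16 * real d * t ^ 2" by (intro mult_left_mono) auto
    then have nM: "n > M" using n(1) X(3) d by linarith
    have nt: "real n * real d powr (- a) = real n / t" by (simp add: t_def powr_minus divide_inverse)
    have "gamma_orth n F = real d powr (- a)" if ?P
      using F(3) g(3) that nM by (simp add: t_def powr_minus divide_inverse)
    \<comment> \<open>The rounded equality holds in both cases, as \<open>g\<close> is always the
      floor of n / t; in the exact case \<open>g\<close> equals n / t as well.\<close>
    moreover have "gamma_orth n F = of_int \<lfloor>real n * real d powr (- a)\<rfloor> / real n"
      unfolding nt F(3) g(1)[symmetric] by simp
    ultimately show "\<exists>n>M. n \<in> {n::nat. \<exists>F. F \<subseteq> cube n \<and>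
      (if ?P then gamma_orth n F = real (VC n F) powr (- a)
       else gamma_orth n F = of_int \<lfloor>real n * real (VC n F) powr (- a)\<rfloor> / real n) \<and>
      int (card F) = \<lfloor>exp (ln 2 / 16 * real n powr (1 / (2 * a + 1)))\<rfloor>}"
      using F nM by (intro exI[of _ n] conjI CollectI exI[of _ F]) simp_all
  qed
qed

end
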